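(* Let $\mathcal{P}$ be a two-orbit $n$-polytope in the class $2_I$ with base flag $\Phi$, and let $j_0\in N\setminus I$. Then for all $J,K\subseteq N$, \[\Gamma'_J\cap\Gamma'_K=\Gamma'_{J\cup K}\quad\text{and}\quad(\Gamma')^J\cap(\Gamma')^K=(\Gamma')^{J\cap K}.\]
   Context: An (abstract) polytope of rank $n$ is a partially ordered set with a strictly monotone rank function onto $\{-1,\ldots,n\}$, a unique least and unique greatest face, whose maximal chains (flags) each contain $n+2$ faces, satisfying the diamond condition and strong flag-connectedness. For a flag $\Psi$ and $i\in N:=\{0,\ldots,n-1\}$, $\Psi^i$ is the flag differing from $\Psi$ exactly in its $i$-face, $\Psi^{i_1,\ldots,i_l}:=(\Psi^{i_1,\ldots,i_{l-1}})^{i_l}$. $\Gamma=\Gamma(\mathcal{P})$ is the automorphism group (acting on the right). A two-orbit polytope is one whose automorphism group has exactly two flag orbits; it is in class $2_I$ where $I\subsetneq N$ is the (flag-independent) set of $i$ with $\Psi,\Psi^i$ in the same orbit; $\bar I:=N\setminus I$. For $i\in I$, $j,k\in\bar I$ let $\rho'_i,\alpha'_{j,k},\alpha'_{j,i,j}\in\Gamma$ be the unique automorphisms with $\Phi^{j_0}\rho'_i=(\Phi^{j_0})^i$, $\Phi^{j_0}\alpha'_{j,k}=(\Phi^{j_0})^{j,k}$, $\Phi^{j_0}\alpha'_{j,i,j}=(\Phi^{j_0})^{j,i,j}$. For $J\subseteq N$, $\bar J:=N\setminus J$, $\Gamma'_J:=\langle\rho'_i,\alpha'_{j,k},\alpha'_{j,i,j}\mid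 i\in I\cap\bar J;\ j,k\in\bar I\cap\bar J\rangle$ and $(\Gamma')^J:=\Gamma'_{\bar J}$. *)

theory Defs
  imports "HOL-Algebra.Generated_Groups" "HOL-Algebra.Group_Action"
begin

record 'a ranked_poset =
  faces :: "'a set"
  face_le :: "('a \<times> 'a) set"
  rk :: "'a \<Rightarrow> int"

definition face_less :: "'a ranked_poset \<Rightarrow> 'a \<Rightarrow> 'a \<Rightarrow> bool" where
  "face_less P x y \<longleftrightarrow> (x, y) \<in> face_le P \<and> x \<noteq> y"

definition flags :: "'a ranked_poset \<Rightarrow> 'a set set" where
  "flags P = {C. pred_on.maxchain (faces P) (face_less P) C}"

definition i_adjacent :: "'a ranked_poset \<Rightarrow> int \<Rightarrow> 'a set \<Rightarrow> 'a set \<Rightarrow> bool" where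
  "i_adjacent P i X Y \<longleftrightarrow>
     X \<in> flags P \<and> Y \<in> flags P \<and> X \<noteq> Y \<and> {x \<in> X. rk P x \<noteq> i} = {y \<in> Y. rk P y \<noteq> i}"

definition diamond_condition :: "'a ranked_poset \<Rightarrow> bool" where
  "diamond_condition P \<longleftrightarrow>
     (\<forall>x\<in>faces P. \<forall>y\<in>faces P. face_less P x y \<and> rk P y = rk P x + 2 \<longrightarrow>
        card {z \<in> faces P. face_less P x z \<and> face_less P z y} = 2)"

definition strongly_flag_connected :: "'a ranked_poset \<Rightarrow> bool" where
  "strongly_flag_connected P \<longleftrightarrow>
     (\<forall>X\<in>flags P. \<forall>Y\<in>flags P.
        (X, Y) \<in> {(A, B). (\<exists>i. i_adjacent P i A B) \<and> X \<inter> Y \<subseteq> A \<and> X \<inter> Y \<subseteq> B}\<^sup>*)"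

definition abstract_polytope :: "int \<Rightarrow> 'a ranked_poset \<Rightarrow> bool" where
  "abstract_polytope n P \<longleftrightarrow>
     partial_order_on (faces P) (face_le P) \<and>
     rk P ` faces P = {-1..n} \<and>
     (\<forall>x\<in>faces P. \<forall>y\<in>faces P. face_less P x y \<longrightarrow> rk P x < rk P y) \<and>
     (\<exists>!x. x \<in> faces P \<and> (\<forall>y\<in>faces P. (x, y) \<in> face_le P)) \<and>
     (\<exists>!x. x \<in> faces P \<and> (\<forall>y\<in>faces P. (y, x) \<in> face_le P)) \<and>
     (\<forall>C\<in>flags P. int (card C) = n + 2) \<and>
     diamond_condition P \<and>
     strongly_flag_connected P"

definition proper_ranks :: "int \<Rightarrow> int set" where
  "proper_ranks n = {0..n - 1}"

definition adj_flag :: "'a ranked_poset \<Rightarrow> 'a set \<Rightarrow> int \<Rightarrow> 'a set" where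
  "adj_flag P X i = (THE Y. i_adjacent P i X Y)"

definition adj_flags :: "'a ranked_poset \<Rightarrow> 'a set \<Rightarrow> int list \<Rightarrow> 'a set" where
  "adj_flags P X w = foldl (adj_flag P) X w"

text \<open>Automorphisms act on the right: the product of \<open>f\<close> and \<open>g\<close> applies \<open>f\<close> first.\<close>
definition aut_group :: "'a ranked_poset \<Rightarrow> ('a \<Rightarrow> 'a) monoid" where
  "aut_group P =
     \<lparr>carrier = {f \<in> Bij (faces P). \<forall>x\<in>faces P. \<forall>y\<in>faces P.
                   (f x, f y) \<in> face_le P \<longleftrightarrow> (x, y) \<in> face_le P},
      mult = (\<lambda>f g. compose (faces P) g f),
      one = (\<lambda>x\<in>faces P. x)\<rparr>"

definition flag_orbit :: "'a ranked_poset \<Rightarrow> 'a set \<Rightarrow> 'a set set" where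
  "flag_orbit P X = orbit (aut_group P) image X"

definition two_orbit_polytope :: "int \<Rightarrow> 'a ranked_poset \<Rightarrow> bool" where
  "two_orbit_polytope n P \<longleftrightarrow>
     abstract_polytope n P \<and> card (orbits (aut_group P) (flags P) image) = 2"

definition two_orbit_class :: "int \<Rightarrow> 'a ranked_poset \<Rightarrow> int set \<Rightarrow> bool" where
  "two_orbit_class n P I \<longleftrightarrow>
     two_orbit_polytope n P \<and> I \<subset> proper_ranks n \<and>
     (\<forall>X\<in>flags P. I = {i \<in> proper_ranks n. adj_flag P X i \<in> flag_orbit P X})"

text \<open>The automorphism taking the flag \<open>X\<close> to the flag obtained from it along the word \<open>w\<close>;
  it is unique if it exists, since automorphisms act freely on flags.\<close>
definition word_aut :: "'a ranked_poset \<Rightarrow> 'a set \<Rightarrow> int list \<Rightarrow> 'a \<Rightarrow> 'a" where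
  "word_aut P X w = (THE f. f \<in> carrier (aut_group P) \<and> f ` X = adj_flags P X w)"

definition rho' :: "'a ranked_poset \<Rightarrow> 'a set \<Rightarrow> int \<Rightarrow> int \<Rightarrow> 'a \<Rightarrow> 'a" where
  "rho' P \<Phi> j0 i = word_aut P (adj_flag P \<Phi> j0) [i]"

definition alpha2' :: "'a ranked_poset \<Rightarrow> 'a set \<Rightarrow> int \<Rightarrow> int \<Rightarrow> int \<Rightarrow> 'a \<Rightarrow> 'a" where
  "alpha2' P \<Phi> j0 j k = word_aut P (adj_flag P \<Phi> j0) [j, k]"

definition alpha3' :: "'a ranked_poset \<Rightarrow> 'a set \<Rightarrow> int \<Rightarrow> int \<Rightarrow> int \<Rightarrow> 'a \<Rightarrow> 'a" where
  "alpha3' P \<Phi> j0 j i = word_aut P (adj_flag P \<Phi> j0) [j, i, j]"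

definition Gamma'_sub ::
    "int \<Rightarrow> 'a ranked_poset \<Rightarrow> int set \<Rightarrow> 'a set \<Rightarrow> int \<Rightarrow> int set \<Rightarrow> ('a \<Rightarrow> 'a) set" where
  "Gamma'_sub n P I \<Phi> j0 J =
     (let Ibar = proper_ranks n - I; Jbar = proper_ranks n - J in
      generate (aut_group P)
        ({rho' P \<Phi> j0 i | i. i \<in> I \<inter> Jbar} \<union>
         {alpha2' P \<Phi> j0 j k | j k. j \<in> Ibar \<inter> Jbar \<and> k \<in> Ibar \<inter> Jbar} \<union>
         {alpha3' P \<Phi> j0 j i | j i. j \<in> Ibar \<inter> Jbar \<and> i \<in> I \<inter> Jbar}))"

definition Gamma'_sup ::
    "int \<Rightarrow> 'a ranked_poset \<Rightarrow> int set \<Rightarrow> 'a set \<Rightarrow> int \<Rightarrow> int set \<Rightarrow> ('a \<Rightarrow> 'a) set" where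
  "Gamma'_sup n P I \<Phi> j0 J = Gamma'_sub n P I \<Phi> j0 (proper_ranks n - J)"

end

theory Submission
  imports Defs
begin

text \<open>Put \<open>\<Psi> = \<Phi>\<^sup>j\<^sup>0\<close>. The idea is to identify \<open>\<Gamma>'\<^sub>J\<close> with the pointwise stabilizer of
  the faces of \<open>\<Psi>\<close> whose rank lies in \<open>J\<close>; both intersection formulas are then immediate.
  The generators clearly lie in this stabilizer. Conversely, if \<open>f\<close> fixes these faces, strong
  flag-connectedness yields a word \<open>w\<close> over \<open>N - J\<close> with \<open>\<Psi>f = \<Psi>\<^sup>w\<close>. Automorphisms commute with
  passing to adjacent flags, so a prefix \<open>u\<close> of \<open>w\<close> with \<open>\<Psi>\<^sup>u = \<Psi>a\<close> can be split off
  as a factor \<open>a\<close>. One of the prefixes \<open>i\<close>, \<open>jk\<close>, or \<open>jij\<close> (after inserting the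
  trivial \<open>jj\<close>) always applies, unless \<open>w\<close> is a single letter outside \<open>I\<close>, which is
  impossible because then \<open>\<Psi>\<^sup>w\<close> and \<open>\<Psi>\<close> lie in different orbits.\<close>

subsection \<open>Flags and automorphisms of abstract polytopes\<close>

locale polytope =
  fixes n :: int and P :: "'a ranked_poset"
  assumes abstract_polytope: "abstract_polytope n P"
begin

abbreviation less_face :: "'a \<Rightarrow> 'a \<Rightarrow> bool" (infix "\<prec>" 50) where
  "x \<prec> y \<equiv> face_less P x y"

abbreviation \<Gamma> :: "('a \<Rightarrow> 'a) monoid" where
  "\<Gamma> \<equiv> aut_group P"

section \<open>Strict order and rank\<close>

lemma face_less_trans: "x \<prec> y \<Longrightarrow> y \<prec> z \<Longrightarrow> x \<prec> z"
  using abstract_polytope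
  unfolding abstract_polytope_def partial_order_on_def preorder_on_def face_less_def
  by (metis antisymD transD)

lemma face_less_faces: "x \<prec> y \<Longrightarrow> x \<in> faces P \<and> y \<in> faces P"
  using abstract_polytope
  by (auto simp: abstract_polytope_def partial_order_on_def preorder_on_def face_less_def)

lemma rk_less: "x \<prec> y \<Longrightarrow> rk P x < rk P y"
  using abstract_polytope face_less_faces unfolding abstract_polytope_def by blast

lemma rk_range: "x \<in> faces P \<Longrightarrow> rk P x \<in> {-1..n}"
  using abstract_polytope unfolding abstract_polytope_def by blast

lemma rank_ge: "-1 \<le> n"
proof -
  have "faces P \<noteq> {}"
    using abstract_polytope unfolding abstract_polytope_def by blast
  then show ?thesis using rk_range by fastforce
qed

section \<open>Chains, flags and the ranks of their faces\<close>

definition face_chain :: "'a set \<Rightarrow> bool" where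
  "face_chain C \<longleftrightarrow> C \<subseteq> faces P \<and> (\<forall>x\<in>C. \<forall>y\<in>C. x = y \<or> x \<prec> y \<or> y \<prec> x)"

lemma chain_iff: "pred_on.chain (faces P) (face_less P) C \<longleftrightarrow> face_chain C"
  unfolding pred_on.chain_def face_chain_def by auto

lemma face_chain_inj: "face_chain C \<Longrightarrow> inj_on (rk P) C"
  unfolding face_chain_def inj_on_def using rk_less by (metis less_irrefl)

text \<open>Rank is injective on a chain and takes values in \<open>{-1..n}\<close>, a set of
  \<open>n + 2\<close> elements.\<close>

lemma face_chain_card: "face_chain C \<Longrightarrow> finite C \<and> int (card C) \<le> n + 2"
proof -
  assume C: "face_chain C"
  have sub: "rk P ` C \<subseteq> {-1..n}"
    using C rk_range unfolding face_chain_def by blast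
  have fin: "finite C"
    using finite_subset[OF sub] finite_imageD face_chain_inj[OF C] by blast
  have "card C \<le> card {-1..n}"
    using card_inj_on_le[OF face_chain_inj[OF C] sub] by simp
  then show ?thesis using fin rank_ge by auto
qed

text \<open>No chain has more than \<open>n + 2\<close> faces, so a chain with that many cannot be
  extended; the converse is an axiom. Later proofs can thus recognise flags by counting instead of
  checking maximality.\<close>

lemma flag_iff: "X \<in> flags P \<longleftrightarrow> face_chain X \<and> int (card X) = n + 2"
proof
  assume X: "X \<in> flags P"
  then show "face_chain X \<and> int (card X) = n + 2"
    using abstract_polytope
    unfolding flags_def pred_on.maxchain_def chain_iff abstract_polytope_def by blast
next
  assume X: "face_chain X \<and> int (card X) = n + 2"
  have "\<not> (face_chain S \<and> X \<subset> S)" for S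
    using face_chain_card[of S] psubset_card_mono[of S X] X by (metis not_less of_nat_less_iff)
  then show "X \<in> flags P"
    using X unfolding flags_def pred_on.maxchain_def chain_iff by blast
qed

lemma flag_faces: "X \<in> flags P \<Longrightarrow> x \<in> X \<Longrightarrow> x \<in> faces P"
  unfolding flag_iff face_chain_def by blast

lemma flag_finite: "X \<in> flags P \<Longrightarrow> finite X"
  using face_chain_card flag_iff by blast

lemma flag_inj: "X \<in> flags P \<Longrightarrow> inj_on (rk P) X"
  using face_chain_inj flag_iff by blast

lemma flag_rk_image:
  assumes X: "X \<in> flags P"
  shows "rk P ` X = {-1..n}"
proof (rule card_subset_eq)
  show "rk P ` X \<subseteq> {-1..n}" using X rk_range flag_faces by blast
  have "int (card (rk P ` X)) = n + 2"
    using card_image[OF flag_inj[OF X]] X flag_iff by simp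
  then show "card (rk P ` X) = card {-1..n}" using rank_ge by simp
qed simp

lemma flag_obtain_face:
  assumes "X \<in> flags P" "-1 \<le> i" "i \<le> n"
  obtains x where "x \<in> X" "rk P x = i"
  using flag_rk_image[OF assms(1)] assms(2,3) by (metis atLeastAtMost_iff imageE)

lemma flag_less_iff:
  assumes "X \<in> flags P" "x \<in> X" "y \<in> X"
  shows "x \<prec> y \<longleftrightarrow> rk P x < rk P y"
  using assms rk_less unfolding flag_iff face_chain_def by (metis less_asym less_irrefl)

text \<open>This recovers the rank from the order alone, by counting the faces of the flag below
  \<open>x\<close>, which have the ranks from -1 up to \<open>rk P x - 1\<close>. It is the reason
  why order automorphisms preserve rank.\<close>

lemma flag_rk_eq_card:
  assumes X: "X \<in> flags P" and x: "x \<in> X"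
  shows "rk P x = int (card {y \<in> X. y \<prec> x}) - 1"
proof -
  have "rk P ` {y \<in> X. y \<prec> x} = {-1..<rk P x}"
  proof (intro equalityI subsetI)
    fix i assume "i \<in> rk P ` {y \<in> X. y \<prec> x}"
    then show "i \<in> {-1..<rk P x}" using rk_less rk_range flag_faces[OF X] by fastforce
  next
    fix i assume i: "i \<in> {-1..<rk P x}"
    then obtain y where "y \<in> X" "rk P y = i"
      using flag_obtain_face[OF X, of i] rk_range[OF flag_faces[OF X x]] by auto
    then show "i \<in> rk P ` {y \<in> X. y \<prec> x}" using flag_less_iff[OF X _ x] i by auto
  qed
  moreover have "inj_on (rk P) {y \<in> X. y \<prec> x}"
    using flag_inj[OF X] by (auto simp: inj_on_def)
  ultimately have "card {y \<in> X. y \<prec> x} = card {-1..<rk P x}"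
    by (metis card_image)
  then show ?thesis using rk_range[OF flag_faces[OF X x]] by simp
qed

text \<open>Chains have bounded size, so some chain through \<open>x\<close> has the most faces. A
  proper extension of it would be a larger chain through \<open>x\<close>, hence it is
  maximal.\<close>

lemma face_in_flag:
  assumes "x \<in> faces P"
  obtains X where "X \<in> flags P" "x \<in> X"
proof -
  let ?Q = "\<lambda>C. face_chain C \<and> x \<in> C"
  have "?Q {x}" using assms by (simp add: face_chain_def)
  moreover have "\<forall>C. ?Q C \<longrightarrow> card C < nat (n + 3)"
    using face_chain_card by fastforce
  ultimately obtain C where C: "?Q C" and max: "\<forall>D. ?Q D \<longrightarrow> card D \<le> card C"
    using ex_has_greatest_nat[of ?Q "{x}" card] by blast
  have "\<not> (face_chain S \<and> C \<subset> S)" for S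
    using max C face_chain_card[of S] psubset_card_mono[of S C] by (metis not_less psubsetD)
  then have "C \<in> flags P"
    using C unfolding flags_def pred_on.maxchain_def chain_iff by blast
  with C that show thesis by blast
qed

text \<open>Any face other than the least one lies strictly above it and so has rank greater than
  -1. Hence the least face is the only face of rank -1, and every flag has a face of that
  rank.\<close>

lemma least_face_in_flag:
  obtains b where "rk P b = -1" "\<And>X. X \<in> flags P \<Longrightarrow> b \<in> X"
proof -
  obtain b where b: "b \<in> faces P" "\<And>y. y \<in> faces P \<Longrightarrow> (b, y) \<in> face_le P"
    using abstract_polytope unfolding abstract_polytope_def by blast
  have unique: "x = b" if "x \<in> faces P" "rk P x = -1" for x
    using that b rk_less[of b x] rk_range[of b] unfolding face_less_def by fastforce
  obtain y where "y \<in> faces P" "rk P y = -1"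
    using abstract_polytope rank_ge unfolding abstract_polytope_def
    by (metis atLeastAtMost_iff imageE order_refl)
  then have "rk P b = -1" using unique by blast
  moreover have "b \<in> X" if X: "X \<in> flags P" for X
  proof -
    obtain y where y: "y \<in> X" "rk P y = -1" using flag_obtain_face[OF X, of "-1"] rank_ge by auto
    then show ?thesis using unique[of y] flag_faces[OF X] by simp
  qed
  ultimately show thesis using that by blast
qed

lemma greatest_face_in_flag:
  obtains t where "rk P t = n" "\<And>X. X \<in> flags P \<Longrightarrow> t \<in> X"
proof -
  obtain t where t: "t \<in> faces P" "\<And>y. y \<in> faces P \<Longrightarrow> (y, t) \<in> face_le P"
    using abstract_polytope unfolding abstract_polytope_def by blast
  have unique: "x = t" if "x \<in> faces P" "rk P x = n" for x
    using that t rk_less[of x t] rk_range[of t] unfolding face_less_def by fastforce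
  obtain y where "y \<in> faces P" "rk P y = n"
    using abstract_polytope rank_ge unfolding abstract_polytope_def
    by (metis atLeastAtMost_iff imageE order_refl)
  then have "rk P t = n" using unique by blast
  moreover have "t \<in> X" if X: "X \<in> flags P" for X
  proof -
    obtain y where y: "y \<in> X" "rk P y = n" using flag_obtain_face[OF X, of n] rank_ge by auto
    then show ?thesis using unique[of y] flag_faces[OF X] by simp
  qed
  ultimately show thesis using that by blast
qed

section \<open>Adjacent flags\<close>

lemma flag_eqI:
  assumes X: "X \<in> flags P" and Y: "Y \<in> flags P" and "X \<subseteq> Y"
  shows "X = Y"
  using assms card_subset_eq[OF flag_finite[OF Y]] unfolding flag_iff by simp

lemma i_adjacent_sym: "i_adjacent P i X Y \<Longrightarrow> i_adjacent P i Y X"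
  unfolding i_adjacent_def by auto

text \<open>If \<open>x\<close> had rank \<open>i\<close>, it would be the only face of
  \<open>X\<close> of that rank, so all of \<open>X\<close> would lie in \<open>Y\<close>, and the
  flags would coincide.\<close>

lemma i_adjacent_not_common:
  assumes "i_adjacent P i X Y" "x \<in> X" "x \<in> Y"
  shows "rk P x \<noteq> i"
proof
  assume rkx: "rk P x = i"
  have X: "X \<in> flags P" and Y: "Y \<in> flags P" and ne: "X \<noteq> Y"
    and eq: "{x \<in> X. rk P x \<noteq> i} = {y \<in> Y. rk P y \<noteq> i}"
    using assms(1) unfolding i_adjacent_def by auto
  have "y \<in> Y" if "y \<in> X" for y
  proof (cases "rk P y = i")
    case True
    then have "y = x" using inj_onD[OF flag_inj[OF X]] rkx that assms(2) by metis
    then show ?thesis using assms(3) by simp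
  next
    case False
    then show ?thesis using that eq by blast
  qed
  then show False using flag_eqI[OF X Y] ne by blast
qed

text \<open>Strong flag-connectedness speaks of adjacency for an arbitrary integer \<open>i\<close>.
  The ranks -1 and \<open>n\<close> are excluded because all flags share their least and greatest
  faces.\<close>

lemma i_adjacent_proper:
  assumes adj: "i_adjacent P i X Y"
  shows "i \<in> proper_ranks n"
proof (rule ccontr)
  assume not: "i \<notin> proper_ranks n"
  have X: "X \<in> flags P" and Y: "Y \<in> flags P"
    using adj unfolding i_adjacent_def by auto
  obtain b where b: "b \<in> X" "b \<in> Y" "rk P b = -1"
    using least_face_in_flag X Y by metis
  obtain t where t: "t \<in> X" "t \<in> Y" "rk P t = n"
    using greatest_face_in_flag X Y by metis
  have "i \<noteq> -1" "i \<noteq> n"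
    using i_adjacent_not_common[OF adj] b t by auto
  then have "i \<notin> {-1..n}" using not unfolding proper_ranks_def by auto
  \<comment> \<open>No face has rank \<open>i\<close>, so adjacency would compare the whole flags
    and make them equal.\<close>
  then have "{x \<in> X. rk P x \<noteq> i} = X" "{x \<in> Y. rk P x \<noteq> i} = Y"
    using rk_range flag_faces[OF X] flag_faces[OF Y] by blast+
  then show False using adj unfolding i_adjacent_def by (elim conjE) (metis (no_types))
qed

text \<open>By the diamond condition, exactly two faces lie between the faces of \<open>X\<close> of
  ranks \<open>i - 1\<close> and \<open>i + 1\<close>. The adjacent flag arises by exchanging one
  for the other.\<close>

lemma i_adjacent_ex1:
  assumes X: "X \<in> flags P" and i: "i \<in> proper_ranks n"
  shows "\<exists>!Y. i_adjacent P i X Y"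
proof -
  obtain x where x: "x \<in> X" "rk P x = i"
    using flag_obtain_face[OF X, of i] i unfolding proper_ranks_def by auto
  obtain a where a: "a \<in> X" "rk P a = i - 1"
    using flag_obtain_face[OF X, of "i - 1"] i unfolding proper_ranks_def by auto
  obtain c where c: "c \<in> X" "rk P c = i + 1"
    using flag_obtain_face[OF X, of "i + 1"] i unfolding proper_ranks_def by auto
  let ?D = "{z \<in> faces P. a \<prec> z \<and> z \<prec> c}"
  have "a \<prec> c" using flag_less_iff[OF X a(1) c(1)] a c by simp
  then have card: "card ?D = 2"
    using abstract_polytope a c flag_faces[OF X]
    unfolding abstract_polytope_def diamond_condition_def by simp
  have "x \<in> ?D"
    using flag_less_iff[OF X a(1) x(1)] flag_less_iff[OF X x(1) c(1)] a c x flag_faces[OF X] by simp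
  moreover obtain p q where "?D = {p, q}" "p \<noteq> q" using card unfolding card_2_iff by blast
  ultimately obtain z where z: "?D = {x, z}" "z \<noteq> x"
    by (metis doubleton_eq_iff insertE singletonD)
  have "z \<in> ?D" using z by blast
  then have zf: "z \<in> faces P" "a \<prec> z" "z \<prec> c" by auto
  have rkz: "rk P z = i" using rk_less[OF zf(2)] rk_less[OF zf(3)] a c by simp
  let ?Y = "insert z (X - {x})"
  have zX: "z \<notin> X" using inj_onD[OF flag_inj[OF X], of z x] rkz x z(2) by auto
  \<comment> \<open>Remaining faces of rank below \<open>i\<close> lie at or below \<open>a\<close>,
    those of rank above \<open>i\<close> at or above \<open>c\<close>, and \<open>z\<close> lies
    strictly between \<open>a\<close> and \<open>c\<close>.\<close>
  have zcomp: "y \<prec> z \<or> z \<prec> y" if y: "y \<in> X - {x}" for y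
  proof -
    have "rk P y \<noteq> i" using inj_onD[OF flag_inj[OF X], of y x] x y by auto
    then consider "rk P y = i - 1" | "rk P y < i - 1" | "rk P y = i + 1" | "rk P y > i + 1"
      by linarith
    then show ?thesis
    proof cases
      case 1
      then show ?thesis using inj_onD[OF flag_inj[OF X], of y a] a y zf by auto
    next
      case 2
      then show ?thesis using flag_less_iff[OF X _ a(1), of y] a y face_less_trans zf by auto
    next
      case 3
      then show ?thesis using inj_onD[OF flag_inj[OF X], of y c] c y zf by auto
    next
      case 4
      then show ?thesis using flag_less_iff[OF X c(1), of y] c y face_less_trans zf by auto
    qed
  qed
  have "face_chain ?Y"
    using X zf zcomp unfolding flag_iff face_chain_def by blast
  moreover have "card ?Y = card X"
    using flag_finite[OF X] zX x by (simp add: card_Suc_Diff1 del: card_Diff_insert)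
  ultimately have Y: "?Y \<in> flags P" using X unfolding flag_iff by simp
  have eq: "{y \<in> X. rk P y \<noteq> i} = X - {x}"
    using inj_on_eq_iff[OF flag_inj[OF X] _ x(1)] x(2) by auto
  then have "{y \<in> ?Y. rk P y \<noteq> i} = X - {x}" using rkz by blast
  moreover have "X \<noteq> ?Y" using zX by blast
  ultimately have "i_adjacent P i X ?Y"
    unfolding i_adjacent_def using X Y eq by simp
  \<comment> \<open>The \<open>i\<close>-face of \<open>Z\<close> lies in the same diamond and
    differs from \<open>x\<close>, which leaves only \<open>z\<close>.\<close>
  moreover have "Z = ?Y" if Z: "i_adjacent P i X Z" for Z
  proof -
    have ZF: "Z \<in> flags P" and Zeq: "{y \<in> Z. rk P y \<noteq> i} = X - {x}"
      using Z eq unfolding i_adjacent_def by auto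
    obtain y where y: "y \<in> Z" "rk P y = i"
      using flag_obtain_face[OF ZF, of i] i unfolding proper_ranks_def by auto
    have "y \<noteq> x" using i_adjacent_not_common[OF Z] x y by auto
    moreover have "a \<in> X - {x}" "c \<in> X - {x}" using a c x by auto
    then have "a \<in> Z" "c \<in> Z" unfolding Zeq[symmetric] by simp_all
    then have "y \<in> ?D"
      using flag_less_iff[OF ZF] flag_faces[OF ZF] y a c by simp
    ultimately have "y = z" using z by blast
    then have "?Y \<subseteq> Z" using Zeq y by blast
    then show ?thesis using flag_eqI[OF Y ZF] by blast
  qed
  ultimately show ?thesis by blast
qed

lemma adj_flag_adjacent:
  "X \<in> flags P \<Longrightarrow> i \<in> proper_ranks n \<Longrightarrow> i_adjacent P i X (adj_flag P X i)"
  unfolding adj_flag_def using theI'[OF i_adjacent_ex1] .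

lemma adj_flag_eqI:
  assumes "i_adjacent P i X Y"
  shows "adj_flag P X i = Y"
proof -
  have "X \<in> flags P" using assms unfolding i_adjacent_def by simp
  then show ?thesis
    unfolding adj_flag_def
    using the1_equality[OF i_adjacent_ex1 assms] i_adjacent_proper[OF assms] by simp
qed

lemma adj_flag_flag:
  "X \<in> flags P \<Longrightarrow> i \<in> proper_ranks n \<Longrightarrow> adj_flag P X i \<in> flags P"
  using adj_flag_adjacent unfolding i_adjacent_def by blast

lemma adj_flag_adj_flag:
  "X \<in> flags P \<Longrightarrow> i \<in> proper_ranks n \<Longrightarrow> adj_flag P (adj_flag P X i) i = X"
  using adj_flag_adjacent adj_flag_eqI i_adjacent_sym by blast

section \<open>Words of adjacency steps and connectedness\<close>

lemma adj_flags_simps [simp]: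
  "adj_flags P X [] = X"
  "adj_flags P X (i # w) = adj_flags P (adj_flag P X i) w"
  "adj_flags P X (v @ w) = adj_flags P (adj_flags P X v) w"
  unfolding adj_flags_def by simp_all

lemma adj_flags_flag:
  "X \<in> flags P \<Longrightarrow> set w \<subseteq> proper_ranks n \<Longrightarrow> adj_flags P X w \<in> flags P"
  by (induction w arbitrary: X) (auto simp: adj_flag_flag)

lemma adj_flags_fixed_face:
  assumes "X \<in> flags P" "set w \<subseteq> proper_ranks n" "x \<in> X" "rk P x \<notin> set w"
  shows "x \<in> adj_flags P X w"
  using assms
proof (induction w arbitrary: X)
  case (Cons i w)
  have "x \<in> adj_flag P X i"
    using adj_flag_adjacent[of X i] Cons.prems unfolding i_adjacent_def by auto
  then show ?case using Cons adj_flag_flag by simp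
qed simp

text \<open>The connecting path keeps \<open>X \<inter> Y\<close> inside every flag, and a step of
  rank \<open>i\<close> never retains a face of rank \<open>i\<close>. So the letters avoid the
  ranks of common faces.\<close>

lemma flags_connected:
  assumes X: "X \<in> flags P" and Y: "Y \<in> flags P"
  obtains w where "set w \<subseteq> proper_ranks n - rk P ` (X \<inter> Y)" "Y = adj_flags P X w"
proof -
  define R where "R = {(A, B). (\<exists>i. i_adjacent P i A B) \<and> X \<inter> Y \<subseteq> A \<and> X \<inter> Y \<subseteq> B}"
  have "(X, Y) \<in> R\<^sup>*"
    using abstract_polytope X Y
    unfolding R_def abstract_polytope_def strongly_flag_connected_def by simp
  moreover have "\<exists>w. set w \<subseteq> proper_ranks n - rk P ` (X \<inter> Y) \<and> Z = adj_flags P X w"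
    if "(X, Z) \<in> R\<^sup>*" for Z
    using that
  proof (induction rule: rtrancl_induct)
    case base
    show ?case by (rule exI[of _ "[]"]) simp
  next
    case (step A B)
    obtain w where w: "set w \<subseteq> proper_ranks n - rk P ` (X \<inter> Y)" "A = adj_flags P X w"
      using step.IH by (elim exE conjE)
    obtain i where i: "i_adjacent P i A B" "X \<inter> Y \<subseteq> A" "X \<inter> Y \<subseteq> B"
      using step.hyps(2) unfolding R_def by auto
    have "i \<notin> rk P ` (X \<inter> Y)"
      using i_adjacent_not_common[OF i(1)] i(2,3) by blast
    then show ?case
      using w i_adjacent_proper[OF i(1)] adj_flag_eqI[OF i(1)]
      by (intro exI[of _ "w @ [i]"]) auto
  qed
  ultimately show thesis using that by blast
qed

section \<open>The automorphism group\<close>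

lemma carrier_aut:
  "f \<in> carrier \<Gamma> \<longleftrightarrow> f \<in> extensional (faces P) \<and> bij_betw f (faces P) (faces P) \<and>
     (\<forall>x\<in>faces P. \<forall>y\<in>faces P. (f x, f y) \<in> face_le P \<longleftrightarrow> (x, y) \<in> face_le P)"
  unfolding aut_group_def Bij_def by auto

lemma mult_aut: "f \<otimes>\<^bsub>\<Gamma>\<^esub> g = compose (faces P) g f"
  by (simp add: aut_group_def)

lemma one_aut: "\<one>\<^bsub>\<Gamma>\<^esub> = (\<lambda>x\<in>faces P. x)"
  by (simp add: aut_group_def)

lemma aut_face: "f \<in> carrier \<Gamma> \<Longrightarrow> x \<in> faces P \<Longrightarrow> f x \<in> faces P"
  unfolding carrier_aut by (auto dest: bij_betwE)

lemma aut_inj: "f \<in> carrier \<Gamma> \<Longrightarrow> inj_on f (faces P)"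
  unfolding carrier_aut by (auto dest: bij_betw_imp_inj_on)

lemma group_aut: "group \<Gamma>"
proof (rule groupI)
  fix f g assume f: "f \<in> carrier \<Gamma>" and g: "g \<in> carrier \<Gamma>"
  have "compose (faces P) g f \<in> Bij (faces P)"
    using f g by (intro compose_Bij) (auto simp: carrier_aut Bij_def)
  then show "f \<otimes>\<^bsub>\<Gamma>\<^esub> g \<in> carrier \<Gamma>"
    using f g aut_face[OF f] unfolding mult_aut carrier_aut by (auto simp: Bij_def compose_def)
next
  show "\<one>\<^bsub>\<Gamma>\<^esub> \<in> carrier \<Gamma>"
    using id_Bij[of "faces P"] unfolding one_aut carrier_aut by (auto simp: Bij_def)
next
  fix f g h assume f: "f \<in> carrier \<Gamma>" and g: "g \<in> carrier \<Gamma>" and h: "h \<in> carrier \<Gamma>"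
  show "f \<otimes>\<^bsub>\<Gamma>\<^esub> g \<otimes>\<^bsub>\<Gamma>\<^esub> h = f \<otimes>\<^bsub>\<Gamma>\<^esub> (g \<otimes>\<^bsub>\<Gamma>\<^esub> h)"
    unfolding mult_aut using aut_face[OF f] by (auto simp: compose_def fun_eq_iff)
next
  fix f assume f: "f \<in> carrier \<Gamma>"
  then show "\<one>\<^bsub>\<Gamma>\<^esub> \<otimes>\<^bsub>\<Gamma>\<^esub> f = f"
    unfolding mult_aut one_aut carrier_aut
    by (auto simp: compose_def fun_eq_iff extensional_def)
next
  fix f assume f: "f \<in> carrier \<Gamma>"
  then have bij: "bij_betw f (faces P) (faces P)" unfolding carrier_aut by simp
  \<comment> \<open>The inverse is restricted to the faces because group elements must be
    extensional.\<close>
  let ?g = "\<lambda>x\<in>faces P. inv_into (faces P) f x"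
  have gf: "?g x \<in> faces P" "f (?g x) = x" if "x \<in> faces P" for x
    using that bij bij_betw_inv_into_right[OF bij] by (auto simp: bij_betw_def inv_into_into)
  have "?g \<in> Bij (faces P)"
    using f by (intro restrict_inv_into_Bij) (simp add: carrier_aut Bij_def)
  moreover have "(?g x, ?g y) \<in> face_le P \<longleftrightarrow> (x, y) \<in> face_le P"
    if "x \<in> faces P" "y \<in> faces P" for x y
    using f gf[OF that(1)] gf[OF that(2)] unfolding carrier_aut by metis
  ultimately have "?g \<in> carrier \<Gamma>" unfolding carrier_aut Bij_def by auto
  moreover have "?g \<otimes>\<^bsub>\<Gamma>\<^esub> f = \<one>\<^bsub>\<Gamma>\<^esub>"
    unfolding mult_aut one_aut using gf by (auto simp: compose_def fun_eq_iff)
  ultimately show "\<exists>g\<in>carrier \<Gamma>. g \<otimes>\<^bsub>\<Gamma>\<^esub> f = \<one>\<^bsub>\<Gamma>\<^esub>" by blast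
qed

sublocale aut: group "aut_group P"
  by (rule group_aut)

lemma mult_aut_apply: "x \<in> faces P \<Longrightarrow> (f \<otimes>\<^bsub>\<Gamma>\<^esub> g) x = g (f x)"
  by (simp add: mult_aut compose_def)

lemma one_aut_apply: "x \<in> faces P \<Longrightarrow> \<one>\<^bsub>\<Gamma>\<^esub> x = x"
  by (simp add: one_aut)

section \<open>The action of automorphisms on flags\<close>

lemma mult_aut_image: "X \<in> flags P \<Longrightarrow> (f \<otimes>\<^bsub>\<Gamma>\<^esub> g) ` X = g ` f ` X"
  unfolding image_image by (rule image_cong) (simp_all add: mult_aut_apply flag_faces)

lemma one_aut_image: "X \<in> flags P \<Longrightarrow> \<one>\<^bsub>\<Gamma>\<^esub> ` X = X"
  by (simp add: one_aut_apply flag_faces cong: image_cong)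

lemma aut_less_iff:
  assumes "f \<in> carrier \<Gamma>" "x \<in> faces P" "y \<in> faces P"
  shows "f x \<prec> f y \<longleftrightarrow> x \<prec> y"
  using assms inj_on_eq_iff[OF aut_inj[OF assms(1)]] unfolding face_less_def carrier_aut by auto

lemma aut_flag:
  assumes f: "f \<in> carrier \<Gamma>" and X: "X \<in> flags P"
  shows "f ` X \<in> flags P"
proof -
  have sub: "X \<subseteq> faces P" using flag_faces[OF X] by blast
  have "card (f ` X) = card X"
    using card_image inj_on_subset[OF aut_inj[OF f] sub] by blast
  moreover have "f x = f y \<or> f x \<prec> f y \<or> f y \<prec> f x" if "x \<in> X" "y \<in> X" for x y
    using X that sub aut_less_iff[OF f] unfolding flag_iff face_chain_def by (metis subsetD)
  then have "face_chain (f ` X)"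
    using aut_face[OF f] sub unfolding face_chain_def by blast
  ultimately show ?thesis using X unfolding flag_iff by simp
qed

text \<open>Automorphisms are only required to preserve the order. The faces below \<open>x\<close>
  in a flag correspond bijectively to those below \<open>f x\<close> in the image flag, and their
  number determines the rank.\<close>

lemma aut_rk:
  assumes f: "f \<in> carrier \<Gamma>" and x: "x \<in> faces P"
  shows "rk P (f x) = rk P x"
proof -
  obtain X where X: "X \<in> flags P" "x \<in> X" using face_in_flag[OF x] .
  have sub: "{y \<in> X. y \<prec> x} \<subseteq> faces P" using flag_faces[OF X(1)] by blast
  have "{z \<in> f ` X. z \<prec> f x} = f ` {y \<in> X. y \<prec> x}"
    using aut_less_iff[OF f] flag_faces[OF X(1)] x by auto
  then have "card {z \<in> f ` X. z \<prec> f x} = card {y \<in> X. y \<prec> x}"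
    using card_image[OF inj_on_subset[OF aut_inj[OF f] sub]] by simp
  then show ?thesis
    using flag_rk_eq_card[OF X] flag_rk_eq_card[OF aut_flag[OF f X(1)], of "f x"] X by simp
qed

text \<open>Both \<open>x\<close> and \<open>f x\<close> lie in the image flag and have the same
  rank, and a flag has one face of each rank.\<close>

lemma aut_fixes_common_face:
  assumes f: "f \<in> carrier \<Gamma>" and X: "X \<in> flags P" and x: "x \<in> X" "x \<in> f ` X"
  shows "f x = x"
proof -
  have "f x \<in> f ` X" "rk P (f x) = rk P x"
    using x aut_rk[OF f] flag_faces[OF X] by auto
  then show ?thesis using inj_onD[OF flag_inj[OF aut_flag[OF f X]]] x by blast
qed

text \<open>Since \<open>f\<close> preserves order and rank, it carries adjacent flags to adjacent
  flags; uniqueness of the adjacent flag does the rest.\<close>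

lemma aut_adj_flag:
  assumes f: "f \<in> carrier \<Gamma>" and X: "X \<in> flags P" and i: "i \<in> proper_ranks n"
  shows "adj_flag P (f ` X) i = f ` adj_flag P X i"
proof (rule adj_flag_eqI)
  let ?Y = "adj_flag P X i"
  have adj: "i_adjacent P i X ?Y" using adj_flag_adjacent[OF X i] .
  have Y: "?Y \<in> flags P" using adj_flag_flag[OF X i] .
  have restr: "{z \<in> f ` Z. rk P z \<noteq> i} = f ` {z \<in> Z. rk P z \<noteq> i}" if "Z \<in> flags P" for Z
    using aut_rk[OF f] flag_faces[OF that] by auto
  have "X \<subseteq> faces P" "?Y \<subseteq> faces P" using flag_faces[OF X] flag_faces[OF Y] by auto
  then have "f ` X \<noteq> f ` ?Y"
    using adj inj_on_image_eq_iff[OF aut_inj[OF f]] unfolding i_adjacent_def by simp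
  then show "i_adjacent P i (f ` X) (f ` ?Y)"
    using adj aut_flag[OF f] unfolding i_adjacent_def by (simp add: restr)
qed

lemma aut_adj_flags:
  assumes "f \<in> carrier \<Gamma>" "X \<in> flags P" "set w \<subseteq> proper_ranks n"
  shows "adj_flags P (f ` X) w = f ` adj_flags P X w"
  using assms by (induction w arbitrary: X) (auto simp: aut_adj_flag adj_flag_flag)

text \<open>The action on flags is free: agreement on one flag spreads along words to every flag.
  Every face lies in a flag, and its image is determined there by its rank.\<close>

lemma aut_eqI:
  assumes f: "f \<in> carrier \<Gamma>" and g: "g \<in> carrier \<Gamma>" and X: "X \<in> flags P" and eq: "f ` X = g ` X"
  shows "f = g"
proof (rule extensionalityI)
  show "f \<in> extensional (faces P)" "g \<in> extensional (faces P)"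
    using f g unfolding carrier_aut by auto
next
  fix x assume x: "x \<in> faces P"
  obtain Y where Y: "Y \<in> flags P" "x \<in> Y" using face_in_flag[OF x] .
  obtain w where "set w \<subseteq> proper_ranks n - rk P ` (X \<inter> Y)" and wY: "Y = adj_flags P X w"
    using flags_connected[OF X Y(1)] .
  then have w: "set w \<subseteq> proper_ranks n" by auto
  have "f ` Y = g ` Y"
    using aut_adj_flags[OF f X w] aut_adj_flags[OF g X w] wY eq by simp
  then have "f x \<in> f ` Y" "g x \<in> f ` Y" using Y by auto
  moreover have "rk P (f x) = rk P (g x)" using aut_rk f g x by simp
  ultimately show "f x = g x" using inj_onD[OF flag_inj[OF aut_flag[OF f Y(1)]]] by blast
qed

text \<open>This justifies the definite description in \<open>word_aut\<close>: the orbit hypothesis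
  gives existence, freeness gives uniqueness.\<close>

lemma word_aut:
  assumes X: "X \<in> flags P" and w: "adj_flags P X w \<in> flag_orbit P X"
  shows "word_aut P X w \<in> carrier \<Gamma>" "word_aut P X w ` X = adj_flags P X w"
proof -
  have "\<exists>!f. f \<in> carrier \<Gamma> \<and> f ` X = adj_flags P X w"
  proof (rule ex_ex1I)
    show "\<exists>f. f \<in> carrier \<Gamma> \<and> f ` X = adj_flags P X w"
      using w unfolding flag_orbit_def orbit_def by auto
  qed (use aut_eqI[OF _ _ X] in simp)
  from theI'[OF this] show "word_aut P X w \<in> carrier \<Gamma>" "word_aut P X w ` X = adj_flags P X w"
    unfolding word_aut_def by auto
qed

section \<open>Pointwise stabilizers of faces of a flag\<close>

definition face_stabilizer :: "'a set \<Rightarrow> int set \<Rightarrow> ('a \<Rightarrow> 'a) set" where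
  "face_stabilizer X J = {f \<in> carrier \<Gamma>. \<forall>x\<in>X. rk P x \<in> J \<longrightarrow> f x = x}"

lemma face_stabilizer_Un:
  "face_stabilizer X J \<inter> face_stabilizer X K = face_stabilizer X (J \<union> K)"
  unfolding face_stabilizer_def by auto

lemma face_stabilizer_subgroup:
  assumes X: "X \<in> flags P"
  shows "subgroup (face_stabilizer X J) \<Gamma>"
proof (rule aut.subgroupI)
  show "face_stabilizer X J \<subseteq> carrier \<Gamma>" unfolding face_stabilizer_def by blast
  have "\<one>\<^bsub>\<Gamma>\<^esub> \<in> face_stabilizer X J"
    unfolding face_stabilizer_def using one_aut_apply flag_faces[OF X] by simp
  then show "face_stabilizer X J \<noteq> {}" by blast
next
  fix f assume f: "f \<in> face_stabilizer X J"
  then have fc: "f \<in> carrier \<Gamma>" unfolding face_stabilizer_def by simp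
  have "(inv\<^bsub>\<Gamma>\<^esub> f) x = x" if "x \<in> X" "rk P x \<in> J" for x
  proof -
    \<comment> \<open>The left factor acts first and fixes \<open>x\<close>, so the product, which
      is the identity, acts on \<open>x\<close> as the inverse alone.\<close>
    have "(f \<otimes>\<^bsub>\<Gamma>\<^esub> inv\<^bsub>\<Gamma>\<^esub> f) x = (inv\<^bsub>\<Gamma>\<^esub> f) x"
      unfolding mult_aut_apply[OF flag_faces[OF X that(1)]]
      using f that unfolding face_stabilizer_def by simp
    then show ?thesis using aut.r_inv[OF fc] one_aut_apply flag_faces[OF X] that by simp
  qed
  then show "inv\<^bsub>\<Gamma>\<^esub> f \<in> face_stabilizer X J"
    unfolding face_stabilizer_def using fc by simp
next
  fix f g assume "f \<in> face_stabilizer X J" "g \<in> face_stabilizer X J"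
  then show "f \<otimes>\<^bsub>\<Gamma>\<^esub> g \<in> face_stabilizer X J"
    unfolding face_stabilizer_def using mult_aut_apply flag_faces[OF X] by simp
qed

text \<open>The word never changes a face with rank in \<open>J\<close>, so such a face is common to
  \<open>X\<close> and its image and is therefore fixed.\<close>

lemma word_aut_in_face_stabilizer:
  assumes X: "X \<in> flags P" and orb: "adj_flags P X w \<in> flag_orbit P X"
    and w: "set w \<subseteq> proper_ranks n - J"
  shows "word_aut P X w \<in> face_stabilizer X J"
proof -
  have "word_aut P X w x = x" if x: "x \<in> X" "rk P x \<in> J" for x
  proof -
    have "set w \<subseteq> proper_ranks n" "rk P x \<notin> set w" using w x(2) by auto
    then have "x \<in> word_aut P X w ` X"
      using adj_flags_fixed_face[OF X _ x(1)] word_aut(2)[OF X orb] by simp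
    then show ?thesis using aut_fixes_common_face[OF word_aut(1)[OF X orb] X x(1)] by simp
  qed
  then show ?thesis using word_aut(1)[OF X orb] unfolding face_stabilizer_def by simp
qed

section \<open>Flag orbits as equivalence classes\<close>

lemma flag_orbit_refl: "X \<in> flags P \<Longrightarrow> X \<in> flag_orbit P X"
  unfolding flag_orbit_def orbit_def using one_aut_image aut.one_closed by blast

lemma flag_orbit_eq:
  assumes X: "X \<in> flags P" and Y: "Y \<in> flag_orbit P X"
  shows "flag_orbit P Y = flag_orbit P X"
proof -
  obtain f where f: "f \<in> carrier \<Gamma>" "Y = f ` X"
    using Y unfolding flag_orbit_def orbit_def by blast
  have 1: "g ` Y = (f \<otimes>\<^bsub>\<Gamma>\<^esub> g) ` X" for g
    using mult_aut_image[OF X] f by simp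
  have 2: "g ` X = (inv\<^bsub>\<Gamma>\<^esub> f \<otimes>\<^bsub>\<Gamma>\<^esub> g) ` Y" if "g \<in> carrier \<Gamma>" for g
    using 1 f that by (simp add: aut.m_assoc[symmetric])
  show ?thesis
  proof (intro equalityI subsetI)
    fix Z assume "Z \<in> flag_orbit P Y"
    then show "Z \<in> flag_orbit P X"
      unfolding flag_orbit_def orbit_def using 1 f aut.m_closed by blast
  next
    fix Z assume "Z \<in> flag_orbit P X"
    then show "Z \<in> flag_orbit P Y"
      unfolding flag_orbit_def orbit_def using 2 f aut.m_closed aut.inv_closed by blast
  qed
qed

end

subsection \<open>Two-orbit polytopes\<close>

locale two_orbit = polytope n P for n :: int and P :: "'a ranked_poset" +
  fixes I :: "int set"
  assumes two_orbit_class: "two_orbit_class n P I"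
begin

lemma I_proper: "I \<subseteq> proper_ranks n"
  using two_orbit_class unfolding two_orbit_class_def by blast

text \<open>Stated as equality of orbits, so that the effect of successive letters can be combined:
  letters in \<open>I\<close> keep the orbit, the others change it.\<close>

lemma orbit_adj_flag_iff:
  assumes X: "X \<in> flags P" and i: "i \<in> proper_ranks n"
  shows "flag_orbit P (adj_flag P X i) = flag_orbit P X \<longleftrightarrow> i \<in> I"
proof -
  have "i \<in> I \<longleftrightarrow> adj_flag P X i \<in> flag_orbit P X"
    using two_orbit_class X i unfolding two_orbit_class_def by blast
  then show ?thesis
    using flag_orbit_eq[OF X] flag_orbit_refl[OF adj_flag_flag[OF X i]] by blast
qed

text \<open>With exactly two orbits, changing orbit twice leads back to the first.\<close>

lemma flag_orbit_third:
  assumes "X \<in> flags P" "Y \<in> flags P" "Z \<in> flags P"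
    and "flag_orbit P Y \<noteq> flag_orbit P X" "flag_orbit P Z \<noteq> flag_orbit P Y"
  shows "flag_orbit P Z = flag_orbit P X"
proof -
  let ?O = "orbits \<Gamma> (flags P) image"
  have "card ?O = 2"
    using two_orbit_class unfolding two_orbit_class_def two_orbit_polytope_def by blast
  moreover have "flag_orbit P X \<in> ?O" "flag_orbit P Y \<in> ?O" "flag_orbit P Z \<in> ?O"
    using assms unfolding orbits_def flag_orbit_def by blast+
  ultimately show ?thesis using assms(4,5) unfolding card_2_iff by auto
qed

lemma orbit_rho:
  assumes X: "X \<in> flags P" and i: "i \<in> I"
  shows "adj_flags P X [i] \<in> flag_orbit P X"
  using orbit_adj_flag_iff[OF X] flag_orbit_refl[OF adj_flag_flag[OF X]] i I_proper by fastforce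

lemma orbit_alpha2:
  assumes X: "X \<in> flags P" and j: "j \<in> proper_ranks n - I" and k: "k \<in> proper_ranks n - I"
  shows "adj_flags P X [j, k] \<in> flag_orbit P X"
proof -
  let ?Y = "adj_flag P X j" and ?Z = "adj_flag P (adj_flag P X j) k"
  have Y: "?Y \<in> flags P" using adj_flag_flag[OF X] j by blast
  have Z: "?Z \<in> flags P" using adj_flag_flag[OF Y] k by blast
  have "flag_orbit P ?Z = flag_orbit P X"
    using flag_orbit_third[OF X Y Z] orbit_adj_flag_iff[OF X] orbit_adj_flag_iff[OF Y] j k by blast
  then show ?thesis using flag_orbit_refl[OF Z] by simp
qed

text \<open>The first \<open>j\<close> changes the orbit, \<open>i\<close> keeps it, and the second
  \<open>j\<close> changes it back.\<close>

lemma orbit_alpha3: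
  assumes X: "X \<in> flags P" and j: "j \<in> proper_ranks n - I" and i: "i \<in> I"
  shows "adj_flags P X [j, i, j] \<in> flag_orbit P X"
proof -
  let ?Y = "adj_flag P X j" and ?Z = "adj_flag P (adj_flag P X j) i"
  have i': "i \<in> proper_ranks n" using i I_proper by blast
  have Y: "?Y \<in> flags P" using adj_flag_flag[OF X] j by blast
  have Z: "?Z \<in> flags P" using adj_flag_flag[OF Y i'] .
  have W: "adj_flag P ?Z j \<in> flags P" using adj_flag_flag[OF Z] j by blast
  have "flag_orbit P (adj_flag P ?Z j) = flag_orbit P X"
    using flag_orbit_third[OF X Z W] orbit_adj_flag_iff[OF X] orbit_adj_flag_iff[OF Y]
      orbit_adj_flag_iff[OF Z] i i' j by blast
  then show ?thesis using flag_orbit_refl[OF W] by simp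
qed

section \<open>Generating the stabilizers by words over the admissible ranks\<close>

definition generators :: "'a set \<Rightarrow> int set \<Rightarrow> ('a \<Rightarrow> 'a) set" where
  "generators X A =
     {word_aut P X [i] | i. i \<in> I \<inter> A} \<union>
     {word_aut P X [j, k] | j k. j \<in> A - I \<and> k \<in> A - I} \<union>
     {word_aut P X [j, i, j] | j i. j \<in> A - I \<and> i \<in> I \<inter> A}"

lemma generators_subset_stabilizer:
  assumes X: "X \<in> flags P"
  shows "generators X (proper_ranks n - J) \<subseteq> face_stabilizer X J"
  unfolding generators_def
  using word_aut_in_face_stabilizer[OF X orbit_rho[OF X]]
    word_aut_in_face_stabilizer[OF X orbit_alpha2[OF X]]
    word_aut_in_face_stabilizer[OF X orbit_alpha3[OF X]]
  by auto

text \<open>Let \<open>a\<close> be the automorphism of \<open>u\<close>. Following \<open>v\<close>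
  from the image of \<open>X\<close> under \<open>a\<close> gives the image under \<open>a\<close>
  of the flag reached by \<open>v\<close> from \<open>X\<close>. Undoing \<open>a\<close> after
  \<open>f\<close> thus leaves just \<open>v\<close>.\<close>

lemma split_off_word_aut:
  assumes X: "X \<in> flags P" and f: "f \<in> carrier \<Gamma>" and orb: "adj_flags P X u \<in> flag_orbit P X"
    and v: "set v \<subseteq> proper_ranks n" and fX: "f ` X = adj_flags P X (u @ v)"
  shows "f \<otimes>\<^bsub>\<Gamma>\<^esub> inv\<^bsub>\<Gamma>\<^esub> (word_aut P X u) \<in> carrier \<Gamma>"
    and "(f \<otimes>\<^bsub>\<Gamma>\<^esub> inv\<^bsub>\<Gamma>\<^esub> (word_aut P X u)) ` X = adj_flags P X v"
proof -
  let ?a = "word_aut P X u"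
  note a = word_aut[OF X orb]
  show "f \<otimes>\<^bsub>\<Gamma>\<^esub> inv\<^bsub>\<Gamma>\<^esub> ?a \<in> carrier \<Gamma>" using f a by simp
  have "f ` X = ?a ` adj_flags P X v"
    using fX a(2) aut_adj_flags[OF a(1) X v] by simp
  then have "(f \<otimes>\<^bsub>\<Gamma>\<^esub> inv\<^bsub>\<Gamma>\<^esub> ?a) ` X = (?a \<otimes>\<^bsub>\<Gamma>\<^esub> inv\<^bsub>\<Gamma>\<^esub> ?a) ` adj_flags P X v"
    using mult_aut_image[OF X] mult_aut_image[OF adj_flags_flag[OF X v]] by simp
  then show "(f \<otimes>\<^bsub>\<Gamma>\<^esub> inv\<^bsub>\<Gamma>\<^esub> ?a) ` X = adj_flags P X v"
    using aut.r_inv[OF a(1)] one_aut_image[OF adj_flags_flag[OF X v]] by simp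
qed

lemma word_in_generate:
  assumes X: "X \<in> flags P" and A: "A \<subseteq> proper_ranks n"
    and "set w \<subseteq> A" "f \<in> carrier \<Gamma>" "f ` X = adj_flags P X w"
  shows "f \<in> generate \<Gamma> (generators X A)"
  using assms(3-)
proof (induction "length w" arbitrary: w f rule: less_induct)
  case less
  note w = less.prems(1) and f = less.prems(2) and fX = less.prems(3)
  \<comment> \<open>Here \<open>u @ v\<close> need not be \<open>w\<close> itself; it only has to
    lead to the same flag, with \<open>v\<close> shorter than \<open>w\<close>. This freedom allows
    the insertion of a trivial pair of letters.\<close>
  have peel: "f \<in> generate \<Gamma> (generators X A)"
    if u: "word_aut P X u \<in> generators X A" "adj_flags P X u \<in> flag_orbit P X"
      and v: "set v \<subseteq> A" "length v < length w" "f ` X = adj_flags P X (u @ v)" for u v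
  proof -
    let ?a = "word_aut P X u"
    have a: "?a \<in> carrier \<Gamma>" using word_aut(1)[OF X u(2)] .
    have "f \<otimes>\<^bsub>\<Gamma>\<^esub> inv\<^bsub>\<Gamma>\<^esub> ?a \<in> generate \<Gamma> (generators X A)"
      using less.hyps[OF v(2,1)] split_off_word_aut[OF X f u(2) _ v(3)] v(1) A by blast
    then have "f \<otimes>\<^bsub>\<Gamma>\<^esub> inv\<^bsub>\<Gamma>\<^esub> ?a \<otimes>\<^bsub>\<Gamma>\<^esub> ?a \<in> generate \<Gamma> (generators X A)"
      using generate.eng generate.incl[OF u(1)] by fast
    then show ?thesis using f a by (simp add: aut.m_assoc)
  qed
  show ?case
  proof (cases w)
    case Nil
    then have "f = \<one>\<^bsub>\<Gamma>\<^esub>"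
      using aut_eqI[OF f aut.one_closed X] fX one_aut_image[OF X] by simp
    then show ?thesis by (simp add: generate.one)
  next
    case (Cons j v)
    have jA: "j \<in> A" and vA: "set v \<subseteq> A" using Cons w by auto
    show ?thesis
    proof (cases "j \<in> I")
      case True
      have "word_aut P X [j] \<in> generators X A" unfolding generators_def using True jA by blast
      then show ?thesis using peel[of "[j]" v] orbit_rho[OF X True] vA Cons fX by simp
    next
      case False
      then have j: "j \<in> A - I" "j \<in> proper_ranks n - I" using jA A by auto
      show ?thesis
      proof (cases v)
        case Nil
        \<comment> \<open>An automorphism cannot realise a single letter outside \<open>I\<close>,
          since that letter changes the orbit.\<close>
        have "adj_flag P X j \<in> flag_orbit P X"
          using f fX Cons Nil unfolding flag_orbit_def orbit_def by auto
        then have False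
          using flag_orbit_eq[OF X] orbit_adj_flag_iff[OF X] j by blast
        then show ?thesis ..
      next
        case (Cons k v')
        have kA: "k \<in> A" and v'A: "set v' \<subseteq> A" using Cons vA by auto
        have weq: "w = j # k # v'" using \<open>w = j # v\<close> Cons by simp
        show ?thesis
        proof (cases "k \<in> I")
          case True
          have Z: "adj_flags P X [j, k] \<in> flags P" using adj_flags_flag[OF X, of "[j, k]"] jA kA A by auto
          have "word_aut P X [j, k, j] \<in> generators X A"
            unfolding generators_def using True j kA by blast
          \<comment> \<open>Repeating \<open>j\<close> after \<open>j, k\<close> cancels, as passing
            to the adjacent flag is an involution. After splitting off three letters,
            \<open>j # v'\<close> remains, still one letter shorter than \<open>w\<close>.\<close>
          moreover have "f ` X = adj_flags P X ([j, k, j] @ j # v')"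
            using adj_flag_adj_flag[OF Z] j fX weq by simp
          ultimately show ?thesis
            using peel[of "[j, k, j]" "j # v'"] orbit_alpha3[OF X j(2) True] jA v'A weq by simp
        next
          case False
          then have k: "k \<in> A - I" "k \<in> proper_ranks n - I" using kA A by auto
          have "word_aut P X [j, k] \<in> generators X A" unfolding generators_def using j k by blast
          then show ?thesis
            using peel[of "[j, k]" v'] orbit_alpha2[OF X j(2) k(2)] v'A weq fX by simp
        qed
      qed
    qed
  qed
qed

text \<open>The generators fix the required faces; conversely, an element of the stabilizer moves
  \<open>X\<close> along a word avoiding \<open>J\<close>, and such words are generated.\<close>

lemma generate_eq_face_stabilizer:
  assumes X: "X \<in> flags P"
  shows "generate \<Gamma> (generators X (proper_ranks n - J)) = face_stabilizer X J"
proof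
  show "generate \<Gamma> (generators X (proper_ranks n - J)) \<subseteq> face_stabilizer X J"
    using aut.generate_subgroup_incl[OF generators_subset_stabilizer[OF X]
        face_stabilizer_subgroup[OF X]] .
next
  show "face_stabilizer X J \<subseteq> generate \<Gamma> (generators X (proper_ranks n - J))"
  proof
    fix f assume "f \<in> face_stabilizer X J"
    then have f: "f \<in> carrier \<Gamma>" and fix_J: "\<And>x. x \<in> X \<Longrightarrow> rk P x \<in> J \<Longrightarrow> f x = x"
      unfolding face_stabilizer_def by auto
    obtain w where w: "set w \<subseteq> proper_ranks n - rk P ` (X \<inter> f ` X)" "f ` X = adj_flags P X w"
      using flags_connected[OF X aut_flag[OF f X]] .
    \<comment> \<open>A letter in \<open>J\<close> would be the rank of a face of \<open>X\<close>
      fixed by \<open>f\<close>, hence of a face common to \<open>X\<close> and its image, and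
      \<open>w\<close> avoids those ranks.\<close>
    have "i \<notin> J" if i: "i \<in> set w" for i
    proof
      assume iJ: "i \<in> J"
      have "-1 \<le> i" "i \<le> n" using i w(1) unfolding proper_ranks_def by auto
      then obtain x where x: "x \<in> X" "rk P x = i" using flag_obtain_face[OF X] by auto
      then have "x \<in> X \<inter> f ` X" using fix_J iJ by force
      then show False using w(1) i x by blast
    qed
    then show "f \<in> generate \<Gamma> (generators X (proper_ranks n - J))"
      using word_in_generate[OF X _ _ f w(2)] w(1) by blast
  qed
qed

lemma Gamma'_sub_eq_face_stabilizer:
  assumes "\<Phi> \<in> flags P" "j0 \<in> proper_ranks n"
  shows "Gamma'_sub n P I \<Phi> j0 J = face_stabilizer (adj_flag P \<Phi> j0) J"
proof -
  let ?X = "adj_flag P \<Phi> j0" and ?A = "proper_ranks n - J"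
  have "(proper_ranks n - I) \<inter> ?A = ?A - I" by blast
  then have "Gamma'_sub n P I \<Phi> j0 J = generate \<Gamma> (generators ?X ?A)"
    unfolding Gamma'_sub_def generators_def rho'_def alpha2'_def alpha3'_def Let_def by simp
  then show ?thesis using generate_eq_face_stabilizer[OF adj_flag_flag[OF assms]] by simp
qed

end

theorem theorem5:
  fixes P :: "'a ranked_poset" and n :: int and I :: "int set"
    and \<Phi> :: "'a set" and j0 :: int and J K :: "int set"
  assumes "two_orbit_class n P I"
    and "\<Phi> \<in> flags P"
    and "j0 \<in> proper_ranks n - I"
    and "J \<subseteq> proper_ranks n" and "K \<subseteq> proper_ranks n"
  shows "Gamma'_sub n P I \<Phi> j0 J \<inter> Gamma'_sub n P I \<Phi> j0 K = Gamma'_sub n P I \<Phi> j0 (J \<union> K)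
       \<and> Gamma'_sup n P I \<Phi> j0 J \<inter> Gamma'_sup n P I \<Phi> j0 K = Gamma'_sup n P I \<Phi> j0 (J \<inter> K)"
proof -
  interpret two_orbit n P I
    using assms(1) by unfold_locales (auto simp: two_orbit_class_def two_orbit_polytope_def)
  have "j0 \<in> proper_ranks n" using assms(3) by blast
  note stab = Gamma'_sub_eq_face_stabilizer[OF assms(2) this]
  show ?thesis
    \<comment> \<open>The second formula is the first one for complements, by De Morgan: removing
      \<open>J \<inter> K\<close> leaves the union of the two complements.\<close>
    unfolding Gamma'_sup_def stab face_stabilizer_Un by (simp add: Diff_Int)
qed

end
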